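(* Let $p,q>0$. Let $T^{1/2}_{\rm Bass}$ and $T^{1/2,{\rm hom}}_{M=2}$ be the times at which $f_{\rm Bass}(\cdot\,;p,q)$ and $f_{M=2}^{\rm hom}(\cdot\,;p,q)$, respectively, equal $\frac12$. Then $$\frac{T^{1/2}_{\rm Bass}}{T^{1/2,{\rm hom}}_{M=2}}\sim\frac{2}{\log 2}\,\frac{p}{q}\,\log\frac{q}{p},\qquad \frac{q}{p}\to\infty,$$ i.e. the quotient of the two sides tends to $1$ as $\frac{q}{p}\to\infty$.
   Context: $f_{\rm Bass}(t;p,q)=\dfrac{1-e^{-(p+q)t}}{1+\frac{q}{p}e^{-(p+q)t}}$ is the adoption level in the compartmental Bass model $f'=(1-f)(p+qf)$, $f(0)=0$. $f_{M=2}^{\rm hom}(t;p,q)=1-e^{-pt}\dfrac{qe^{-pt}-pe^{-qt}}{q-p}$ ($p\ne q$) is the expected adoption level in the stochastic Bass model on the homogeneous two-node network, in which each of the two nodes is initially a nonadopter and adopts (irreversibly) at rate $p$ if the other node has not adopted and at rate $p+q$ if the other node has adopted. *)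

theory Defs
  imports Complex_Main "HOL-Library.Landau_Symbols"
begin

definition f_Bass :: "real \<Rightarrow> real \<Rightarrow> real \<Rightarrow> real" where
  "f_Bass t p q = (1 - exp (- (p + q) * t)) / (1 + q / p * exp (- (p + q) * t))"

(* Only meaningful for p \<noteq> q. *)
definition f_hom2 :: "real \<Rightarrow> real \<Rightarrow> real \<Rightarrow> real" where
  "f_hom2 t p q = 1 - exp (- p * t) * ((q * exp (- p * t) - p * exp (- q * t)) / (q - p))"

definition T_half_Bass :: "real \<Rightarrow> real \<Rightarrow> real" where
  "T_half_Bass p q = (THE t. 0 \<le> t \<and> f_Bass t p q = 1 / 2)"

definition T_half_hom2 :: "real \<Rightarrow> real \<Rightarrow> real" where
  "T_half_hom2 p q = (THE t. 0 \<le> t \<and> f_hom2 t p q = 1 / 2)"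

(* The limit q / p \<rightarrow> \<infinity> over positive p and q, both of which may vary. *)
definition ratio_at_top :: "(real \<times> real) filter" where
  "ratio_at_top = inf (filtercomap (\<lambda>(p, q). q / p) at_top) (principal {(p, q). 0 < p \<and> 0 < q})"

lemma eventually_ratio_at_top:
  "eventually P ratio_at_top \<longleftrightarrow> (\<exists>C. \<forall>p q. 0 < p \<longrightarrow> 0 < q \<longrightarrow> C \<le> q / p \<longrightarrow> P (p, q))"
  unfolding ratio_at_top_def eventually_inf_principal
  by (auto simp: eventually_filtercomap_at_top_linorder)

lemma f_Bass_ode:
  assumes "0 < p" "0 < q"
  shows "f_Bass 0 p q = 0"
    and "((\<lambda>t. f_Bass t p q) has_real_derivative
           (1 - f_Bass t p q) * (p + q * f_Bass t p q)) (at t)"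
proof -
  show "f_Bass 0 p q = 0" by (simp add: f_Bass_def)
  define E where "E = exp (- (p + q) * t)"
  have E: "0 < E" by (simp add: E_def)
  have d: "p + q * E > 0" "1 + q / p * E > 0"
    using assms E by (simp_all add: add_pos_pos)
  have dE: "((\<lambda>t. exp (- (p + q) * t)) has_real_derivative - (p + q) * E) (at t)"
    unfolding E_def by (auto intro!: derivative_eq_intros)
  have "((\<lambda>t. f_Bass t p q) has_real_derivative
      ((p + q) * E * (1 + q / p * E) - (1 - E) * (- (q / p * (p + q) * E))) / (1 + q / p * E)\<^sup>2) (at t)"
    unfolding f_Bass_def
    by (rule DERIV_cong[OF DERIV_divide[OF DERIV_diff[OF DERIV_const dE]
          DERIV_add[OF DERIV_const DERIV_cmult[OF dE]]]])
       (use d(2) assms in \<open>unfold E_def[symmetric], simp_all add: power2_eq_square field_simps\<close>)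
  also have "((p + q) * E * (1 + q / p * E) - (1 - E) * (- (q / p * (p + q) * E))) / (1 + q / p * E)\<^sup>2
      = (1 - (1 - E) / (1 + q / p * E)) * (p + q * ((1 - E) / (1 + q / p * E)))"
    using d assms by (simp add: divide_simps) (simp add: power2_eq_square algebra_simps)
  finally show "((\<lambda>t. f_Bass t p q) has_real_derivative
           (1 - f_Bass t p q) * (p + q * f_Bass t p q)) (at t)"
    by (simp add: f_Bass_def E_def)
qed

(* With X1, X2 the adoption states, f = E X1 satisfies
   f' = E ((1 - X1) * (p + q * X2)) = (p + q) * (1 - f) - q * P (X1 = X2 = 0),
   and the probability that neither node has adopted by time t is exp (- 2 * p * t). *)
lemma f_hom2_ode:
  assumes "p \<noteq> q"
  shows "f_hom2 0 p q = 0"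
    and "((\<lambda>t. f_hom2 t p q) has_real_derivative
           (p + q) * (1 - f_hom2 t p q) - q * exp (- 2 * p * t)) (at t)"
proof -
  show "f_hom2 0 p q = 0" using assms by (simp add: f_hom2_def)
  have e: "exp (- 2 * p * t) = exp (- p * t) * exp (- p * t)"
    by (simp flip: exp_add)
  define A B where "A = exp (- p * t)" and "B = exp (- q * t)"
  have dA: "((\<lambda>t. exp (- p * t)) has_real_derivative - p * A) (at t)"
    and dB: "((\<lambda>t. exp (- q * t)) has_real_derivative - q * B) (at t)"
    unfolding A_def B_def by (auto intro!: derivative_eq_intros)
  have "((\<lambda>t. f_hom2 t p q) has_real_derivative
      (p * A * ((q * A - p * B) / (q - p)) + A * ((q * p * A - p * q * B) / (q - p)))) (at t)"
    unfolding f_hom2_def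
    by (rule DERIV_cong[OF DERIV_diff[OF DERIV_const DERIV_mult[OF dA
          DERIV_cdivide[OF DERIV_diff[OF DERIV_cmult[OF dA] DERIV_cmult[OF dB]]]]]])
       (use assms in \<open>unfold A_def[symmetric] B_def[symmetric], simp add: divide_simps, simp add: algebra_simps\<close>)
  also have "p * A * ((q * A - p * B) / (q - p)) + A * ((q * p * A - p * q * B) / (q - p))
      = (p + q) * (A * ((q * A - p * B) / (q - p))) - q * (A * A)"
    using assms by (simp add: divide_simps) (simp add: algebra_simps)
  finally show "((\<lambda>t. f_hom2 t p q) has_real_derivative
           (p + q) * (1 - f_hom2 t p q) - q * exp (- 2 * p * t)) (at t)"
    unfolding e by (simp add: f_hom2_def A_def B_def)
qed

end

theory Submission
  imports Defs "HOL-Real_Asymp.Real_Asymp"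
begin

text \<open>
  Write \<open>r = q / p\<close>. The two half-adoption times separate asymptotically:
  \<open>T_half_Bass p q \<sim> ln r / q\<close> and \<open>T_half_hom2 p q \<sim> ln 2 / (2 * p)\<close>, and the quotient of the
  right-hand sides is the claimed one.

  In the compartmental model \<open>f_Bass t p q = 1 / 2\<close> is linear in \<open>exp (- (p + q) * t)\<close>, which gives
  the closed form \<open>ln (2 + r) / (p + q)\<close>. On two nodes, once \<open>q\<close> is large the second node adopts
  almost immediately after the first, so the level \<open>1 / 2\<close> is reached when the first adoption has
  probability \<open>1 / 2\<close>, that is when \<open>exp (- 2 * p * t) = 1 / 2\<close>. Precisely,
  \<open>1 - f_hom2 t p q\<close> lies between \<open>exp (- 2 * p * t)\<close> and \<open>r / (r - 1) * exp (- 2 * p * t)\<close>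
  (lemma \<open>f_hom2_bounds\<close>). This traps the half-adoption time in an interval whose endpoints are both
  asymptotic to \<open>ln 2 / (2 * p)\<close>; the time is well defined because the adoption level is strictly
  increasing.
\<close>

lemma T_half_Bass_eq:
  assumes "0 < p" "0 < q"
  shows "T_half_Bass p q = ln (2 + q / p) / (p + q)"
proof -
  have r: "0 < q / p" using assms by simp
  have half_iff: "f_Bass t p q = 1 / 2 \<longleftrightarrow> t = ln (2 + q / p) / (p + q)" for t
  proof -
    define E where "E = exp (- (p + q) * t)"
    have E: "0 < E" by (simp add: E_def)
    have "0 < 1 + q / p * E" using r E by (intro add_pos_pos mult_pos_pos) auto
    then have "f_Bass t p q = 1 / 2 \<longleftrightarrow> 2 * (1 - E) = 1 + q / p * E"
      unfolding f_Bass_def E_def[symmetric] by (subst frac_eq_eq) (auto simp: mult.commute)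
    also have "\<dots> \<longleftrightarrow> (2 + q / p) * E = 1"
      by (auto simp: algebra_simps)
    also have "\<dots> \<longleftrightarrow> 2 + q / p = exp ((p + q) * t)"
    proof -
      have "E = inverse (exp ((p + q) * t))"
        unfolding E_def by (metis exp_minus mult_minus_left)
      then show ?thesis by (simp only: divide_inverse[symmetric] divide_eq_1_iff) simp
    qed
    also have "\<dots> \<longleftrightarrow> ln (2 + q / p) = (p + q) * t"
      using r by (metis add_pos_pos exp_ln ln_exp zero_less_numeral)
    also have "\<dots> \<longleftrightarrow> t = ln (2 + q / p) / (p + q)"
      using assms by (auto simp: field_simps)
    finally show ?thesis .
  qed
  have "0 \<le> ln (2 + q / p) / (p + q)"
    using assms r by (intro divide_nonneg_pos ln_ge_zero) auto
  then show ?thesis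
    unfolding T_half_Bass_def half_iff by (intro the_equality) auto
qed

text \<open>
  The derivative of the adoption level is a positive multiple of
  \<open>2 * q * exp (- p * t) - (p + q) * exp (- q * t)\<close>, in which for \<open>p < q\<close> and \<open>0 \<le> t\<close> the first term
  has both the larger coefficient and the larger exponential.
\<close>
lemma f_hom2_strict_mono:
  assumes "0 < p" "p < q" "0 \<le> s" "s < t"
  shows "f_hom2 s p q < f_hom2 t p q"
proof (rule DERIV_pos_imp_increasing[OF \<open>s < t\<close>])
  fix u assume u: "s \<le> u" "u \<le> t"
  define A B where "A = exp (- p * u)" and "B = exp (- q * u)"
  have AB: "0 < A" "0 < B" "B \<le> A"
    using assms u by (auto simp: A_def B_def mult_right_mono)
  have e: "exp (- 2 * p * u) = A * A"
    unfolding A_def by (simp flip: exp_add)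
  have "(p + q) * B < 2 * q * A"
    using assms AB by (intro mult_less_le_imp_less) auto
  then have "0 < p * A * (2 * q * A - (p + q) * B) / (q - p)"
    using assms AB by simp
  also have "\<dots> = (p + q) * (1 - f_hom2 u p q) - q * exp (- 2 * p * u)"
    using assms unfolding e f_hom2_def A_def[symmetric] B_def[symmetric]
    by (simp add: divide_simps) (simp add: algebra_simps)
  finally show "\<exists>y. ((\<lambda>t. f_hom2 t p q) has_real_derivative y) (at u) \<and> 0 < y"
    using f_hom2_ode(2)[of p q u] assms by blast
qed

text \<open>
  The lower bound replaces \<open>exp (- q * t)\<close> by the larger \<open>exp (- p * t)\<close>, the upper one drops it.
\<close>
lemma f_hom2_bounds:
  assumes "0 < p" "p < q" "0 \<le> t"
  shows "exp (- 2 * p * t) \<le> 1 - f_hom2 t p q"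
    and "1 - f_hom2 t p q \<le> q / (q - p) * exp (- 2 * p * t)"
proof -
  define A B where "A = exp (- p * t)" and "B = exp (- q * t)"
  have AB: "0 < A" "0 < B" "B \<le> A"
    using assms by (auto simp: A_def B_def mult_right_mono)
  have e: "exp (- 2 * p * t) = A * A"
    unfolding A_def by (simp flip: exp_add)
  have f: "1 - f_hom2 t p q = A * (q * A - p * B) / (q - p)"
    by (simp add: f_hom2_def A_def B_def)
  have "A * (p * B) \<le> A * (p * A)" "0 \<le> A * (p * B)"
    using assms AB by (auto intro!: mult_left_mono)
  then have "A * A * (q - p) \<le> A * (q * A - p * B)" "A * (q * A - p * B) \<le> q * (A * A)"
    by (simp_all add: algebra_simps)
  then show "exp (- 2 * p * t) \<le> 1 - f_hom2 t p q"
    and "1 - f_hom2 t p q \<le> q / (q - p) * exp (- 2 * p * t)"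
    using assms unfolding e f by (simp_all add: pos_le_divide_eq divide_right_mono)
qed

lemma T_half_hom2_bounds:
  assumes "0 < p" "p < q"
  shows "ln 2 / (2 * p) \<le> T_half_hom2 p q"
    and "T_half_hom2 p q \<le> ln (2 * q / (q - p)) / (2 * p)"
proof -
  define a b where "a = ln 2 / (2 * p)" and "b = ln (2 * q / (q - p)) / (2 * p)"
  have c: "2 < 2 * q / (q - p)" using assms by (simp add: field_simps)
  have a: "0 \<le> a" using assms by (simp add: a_def)
  have ab: "a \<le> b"
    unfolding a_def b_def using assms c by (intro divide_right_mono) auto
  have ea: "exp (- 2 * p * a) = 1 / 2"
    using assms by (simp add: a_def exp_minus)
  have eb: "q / (q - p) * exp (- 2 * p * b) = 1 / 2"
    using assms c by (simp add: b_def exp_minus field_simps)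
  have fa: "f_hom2 a p q \<le> 1 / 2"
    using f_hom2_bounds(1)[OF assms a] ea by linarith
  have fb: "1 / 2 \<le> f_hom2 b p q"
    using f_hom2_bounds(2)[OF assms, of b] eb a ab by linarith
  have "isCont (\<lambda>t. f_hom2 t p q) x" for x
    using f_hom2_ode(2)[of p q x] assms by (intro DERIV_isCont) auto
  then obtain t where t: "a \<le> t" "t \<le> b" "f_hom2 t p q = 1 / 2"
    using IVT[of "\<lambda>t. f_hom2 t p q" a "1 / 2" b] fa fb ab by blast
  have "T_half_hom2 p q = t"
    unfolding T_half_hom2_def
  proof (rule the_equality)
    show "0 \<le> t \<and> f_hom2 t p q = 1 / 2" using t a by simp
    show "s = t" if "0 \<le> s \<and> f_hom2 s p q = 1 / 2" for s
      using f_hom2_strict_mono[OF assms, of s t] f_hom2_strict_mono[OF assms, of t s] that t a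
      by (cases s t rule: linorder_cases) auto
  qed
  then show "ln 2 / (2 * p) \<le> T_half_hom2 p q"
    and "T_half_hom2 p q \<le> ln (2 * q / (q - p)) / (2 * p)"
    using t by (simp_all add: a_def b_def)
qed

lemma filterlim_ratio_at_top: "filterlim (\<lambda>(p, q). q / p) at_top ratio_at_top"
  unfolding ratio_at_top_def
  by (rule filterlim_mono[OF filterlim_filtercomap order_refl]) simp

lemma eventually_ratio_at_topI:
  assumes "\<And>p q. 0 < p \<Longrightarrow> p < q \<Longrightarrow> P (p, q)"
  shows "eventually P ratio_at_top"
  unfolding eventually_ratio_at_top
  by (rule exI[of _ 2]) (use assms in \<open>auto simp: le_divide_eq\<close>)

lemma T_half_Bass_asymp:
  "(\<lambda>(p, q). T_half_Bass p q) \<sim>[ratio_at_top] (\<lambda>(p, q). ln (q / p) / q)"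
proof (rule asymp_equivI')
  define h where "h r = ln (2 + r) / ln r * (r / (1 + r))" for r :: real
  have "(h \<longlongrightarrow> 1) at_top"
    unfolding h_def by real_asymp
  then have "((\<lambda>x. h (case x of (p, q) \<Rightarrow> q / p)) \<longlongrightarrow> 1) ratio_at_top"
    by (rule filterlim_compose[OF _ filterlim_ratio_at_top])
  moreover have "\<forall>\<^sub>F x in ratio_at_top. h (case x of (p, q) \<Rightarrow> q / p)
      = (case x of (p, q) \<Rightarrow> T_half_Bass p q) / (case x of (p, q) \<Rightarrow> ln (q / p) / q)"
  proof (rule eventually_ratio_at_topI)
    fix p q :: real assume pq: "0 < p" "p < q"
    have "q / p / (1 + q / p) = q / (p + q)"
      using pq by (simp add: field_simps)
    then show "h (case (p, q) of (p, q) \<Rightarrow> q / p)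
        = (case (p, q) of (p, q) \<Rightarrow> T_half_Bass p q) / (case (p, q) of (p, q) \<Rightarrow> ln (q / p) / q)"
      using pq by (simp add: h_def T_half_Bass_eq)
  qed
  ultimately show "((\<lambda>x. (case x of (p, q) \<Rightarrow> T_half_Bass p q)
      / (case x of (p, q) \<Rightarrow> ln (q / p) / q)) \<longlongrightarrow> 1) ratio_at_top"
    by (rule Lim_transform_eventually)
qed

lemma T_half_hom2_asymp:
  "(\<lambda>(p, q). T_half_hom2 p q) \<sim>[ratio_at_top] (\<lambda>(p, q). ln 2 / (2 * p))"
proof (rule asymp_equivI')
  define h where "h r = ln (2 * r / (r - 1)) / ln 2" for r :: real
  have "(h \<longlongrightarrow> 1) at_top"
    unfolding h_def by real_asymp
  then have upper: "((\<lambda>x. h (case x of (p, q) \<Rightarrow> q / p)) \<longlongrightarrow> 1) ratio_at_top"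
    by (rule filterlim_compose[OF _ filterlim_ratio_at_top])
  show "((\<lambda>x. (case x of (p, q) \<Rightarrow> T_half_hom2 p q)
      / (case x of (p, q) \<Rightarrow> ln 2 / (2 * p))) \<longlongrightarrow> 1) ratio_at_top"
  proof (rule tendsto_sandwich[OF _ _ tendsto_const upper]; rule eventually_ratio_at_topI)
    fix p q :: real assume pq: "0 < p" "p < q"
    show "1 \<le> (case (p, q) of (p, q) \<Rightarrow> T_half_hom2 p q)
        / (case (p, q) of (p, q) \<Rightarrow> ln 2 / (2 * p))"
      using T_half_hom2_bounds(1)[OF pq] pq by (simp add: field_simps)
    have "2 * (q / p) / (q / p - 1) = 2 * q / (q - p)"
      using pq by (simp add: field_simps)
    then show "(case (p, q) of (p, q) \<Rightarrow> T_half_hom2 p q)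
        / (case (p, q) of (p, q) \<Rightarrow> ln 2 / (2 * p)) \<le> h (case (p, q) of (p, q) \<Rightarrow> q / p)"
      using T_half_hom2_bounds(2)[OF pq] pq by (simp add: h_def field_simps)
  qed
qed

theorem mainTheorem6:
  "(\<lambda>(p, q). T_half_Bass p q / T_half_hom2 p q)
     \<sim>[ratio_at_top] (\<lambda>(p, q). 2 / ln 2 * (p / q) * ln (q / p))"
  using asymp_equiv_divide[OF T_half_Bass_asymp T_half_hom2_asymp]
  by (simp add: case_prod_unfold mult_ac)

end
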